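(* Let $n>1$ be an integer such that $\sigma(n)=2n+k$ for some integer $k$ with $0\le k\le 5$. Then there is at least one divisor $d$ of $n$ such that, in the divisor voting system of $n$, the Banzhaf power index of the player $d$ is different from the Shapley-Shubik power index of the player $d$.
   Context: $\sigma(n)$ denotes the sum of all positive divisors of $n$. A weighted voting system consists of finitely many players, each with a weight, and a quota $Q$. A coalition is a set of players, and its total voting power is the sum of the weights of its members. A coalition is winning if its total voting power meets or exceeds $Q$. A player is critical in a winning coalition containing it if removing the player makes the coalition no longer winning. Banzhaf power index of a player: the number of winning coalitions in which that player is critical, divided by the sum over all players of the numbers of winning coalitions in which they are critical. Shapley-Shubik power index of a player: a sequential coalition is a permutation (ordering) of all the players. Adding up the weights from the beginning of the ordering, the player whose weight first causes the partial sum to meet or exceed $Q$ is the pivotal player of that ordering. The Shapley-Shubik index of a player is the number of orderings in which that player is pivotal, divided by the total number of orderings. Divisor voting system of an integer $n>1$: the players are the positive divisors of $n$ (including $1$ and $n$), each divisor $d$ having weight $d$, and the quota is $Q=(\sigma(n)+1)/2$ if $\sigma(n)$ is even and $Q=\sigma(n)/2$ if $\sigma(n)$ is odd (so, the weights being integers, a coalition wins exactly when its total voting power is strictly more than half of $\sigma(n)$). *)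

theory Defs
  imports Complex_Main "HOL-Combinatorics.Multiset_Permutations"
begin

definition sigma :: "nat \<Rightarrow> nat" where
  "sigma n = (\<Sum>d | d dvd n. d)"

(* The player set is meant to be finite; it is not the whole type, so that the
   divisors of a number can serve as players. *)
record 'a voting_system =
  players :: "'a set"
  weight :: "'a \<Rightarrow> real"
  quota :: real

definition voting_power :: "'a voting_system \<Rightarrow> 'a set \<Rightarrow> real" where
  "voting_power V C = (\<Sum>p\<in>C. weight V p)"

definition winning :: "'a voting_system \<Rightarrow> 'a set \<Rightarrow> bool" where
  "winning V C \<longleftrightarrow> C \<subseteq> players V \<and> voting_power V C \<ge> quota V"

definition critical :: "'a voting_system \<Rightarrow> 'a set \<Rightarrow> 'a \<Rightarrow> bool" where
  "critical V C p \<longleftrightarrow> winning V C \<and> p \<in> C \<and> \<not> winning V (C - {p})"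

definition critical_count :: "'a voting_system \<Rightarrow> 'a \<Rightarrow> nat" where
  "critical_count V p = card {C. critical V C p}"

definition banzhaf_index :: "'a voting_system \<Rightarrow> 'a \<Rightarrow> real" where
  "banzhaf_index V p =
     real (critical_count V p) / real (\<Sum>q\<in>players V. critical_count V q)"

(* Sequential coalitions are the duplicate-free lists enumerating all players. *)
definition sequential_coalitions :: "'a voting_system \<Rightarrow> 'a list set" where
  "sequential_coalitions V = permutations_of_set (players V)"

(* The total weight of the first i players of the ordering xs. *)
definition partial_sum :: "'a voting_system \<Rightarrow> 'a list \<Rightarrow> nat \<Rightarrow> real" where
  "partial_sum V xs i = (\<Sum>p\<leftarrow>take i xs. weight V p)"

definition pivotal :: "'a voting_system \<Rightarrow> 'a list \<Rightarrow> 'a \<Rightarrow> bool" where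
  "pivotal V xs p \<longleftrightarrow>
     (\<exists>i<length xs. xs ! i = p \<and> partial_sum V xs (Suc i) \<ge> quota V \<and>
        (\<forall>j\<le>i. partial_sum V xs j < quota V))"

definition shapley_shubik_index :: "'a voting_system \<Rightarrow> 'a \<Rightarrow> real" where
  "shapley_shubik_index V p =
     real (card {xs \<in> sequential_coalitions V. pivotal V xs p}) /
     real (card (sequential_coalitions V))"

definition divisor_voting_system :: "nat \<Rightarrow> nat voting_system" where
  "divisor_voting_system n =
     \<lparr>players = {d. d dvd n},
      weight = real,
      quota = (if even (sigma n) then (real (sigma n) + 1) / 2 else real (sigma n) / 2)\<rparr>"

end

theory Submission
  imports Defs "HOL-Computational_Algebra.Primes"
begin

text \<open>Call \<open>S\<close> a swing of the player \<open>p\<close> if \<open>S\<close> loses and \<open>S\<close> with \<open>p\<close> added wins. The Banzhaf index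
  counts the swings of \<open>p\<close>; in the Shapley-Shubik index a swing \<open>S\<close> gets the weight
  \<open>fact \<bar>S\<bar> * fact (t - 1 - \<bar>S\<bar>)\<close>, where \<open>t\<close> is the number of players. Let \<open>m\<close> be the number of
  proper divisors of \<open>n\<close>. Since they sum to \<open>n + k\<close>, a swing of a proper divisor either consists of
  \<open>n\<close> and a set of sum at most \<open>k / 2\<close>, or omits \<open>n\<close>, the player and a set of sum less than \<open>k / 2\<close>.
  For \<open>k \<le> 5\<close> such a set is empty or a singleton, and all swing counts become explicit. If
  \<open>k = 2\<close>, or if \<open>k \<ge> 4\<close> and \<open>n\<close> is even, comparing the ratio of the indices of two proper divisors
  would give \<open>m = 3\<close>. In the other cases all swing-capable proper divisors are alike, and comparing one
  of them with the total would give one of \<open>2 ^ m = m\<^sup>2 + 1\<close>, \<open>2 ^ m = m\<^sup>2 - m + 2\<close>,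
  \<open>2 ^ m = 2 * m\<^sup>2 - 6 * m + 8\<close>. All of this is impossible, because \<open>m \<ge> 5\<close> unless \<open>n = 6\<close>.\<close>

section \<open>Swings in a general voting system\<close>

definition swings :: "'a voting_system \<Rightarrow> 'a \<Rightarrow> 'a set set" where
  "swings V p = {S. S \<subseteq> players V - {p} \<and> \<not> winning V S \<and> winning V (insert p S)}"

lemma finite_swings: "finite (players V) \<Longrightarrow> finite (swings V p)"
  by (rule finite_subset[of _ "Pow (players V)"]) (auto simp: swings_def)

text \<open>Inserting \<open>p\<close> is a bijection from the swings of \<open>p\<close> onto the
  coalitions in which \<open>p\<close> is critical; removing \<open>p\<close> inverts it.\<close>

lemma critical_count_eq_card_swings:
  "critical_count V p = card (swings V p)"
proof -
  have "{C. critical V C p} = insert p ` swings V p"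
  proof safe
    fix C assume "critical V C p"
    then show "C \<in> insert p ` swings V p"
      by (intro image_eqI[of _ _ "C - {p}"])
         (auto simp: critical_def swings_def winning_def insert_absorb)
  next
    fix S assume "S \<in> swings V p"
    moreover from this have "insert p S - {p} = S"
      by (auto simp: swings_def)
    ultimately show "critical V (insert p S) p"
      by (auto simp: swings_def critical_def)
  qed
  moreover have "inj_on (insert p) (swings V p)"
    by (auto simp: inj_on_def swings_def)
  ultimately show ?thesis
    by (simp add: critical_count_def card_image)
qed

lemma partial_sum_mono:
  assumes "\<And>q. q \<in> set xs \<Longrightarrow> 0 \<le> weight V q" and "i \<le> j"
  shows "partial_sum V xs i \<le> partial_sum V xs j"
proof -
  have "take j xs = take i xs @ take (j - i) (drop i xs)"
    using assms(2) by (metis le_add_diff_inverse take_add)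
  moreover have "0 \<le> (\<Sum>q\<leftarrow>take (j - i) (drop i xs). weight V q)"
    by (intro sum_list_nonneg) (use assms(1) in \<open>auto dest!: in_set_takeD in_set_dropD\<close>)
  ultimately show ?thesis by (simp add: partial_sum_def)
qed

text \<open>Nonnegative weights make partial sums monotone, so of all the conditions on earlier
  partial sums only the one just before \<open>p\<close> matters. It says that the set of
  predecessors of \<open>p\<close> loses.\<close>

lemma pivotal_append_Cons_iff:
  assumes "distinct (ys @ p # zs)" and "set (ys @ p # zs) = players V"
    and "\<And>q. q \<in> players V \<Longrightarrow> 0 \<le> weight V q"
  shows "pivotal V (ys @ p # zs) p \<longleftrightarrow> set ys \<in> swings V p"
proof -
  let ?xs = "ys @ p # zs"
  have nth: "i = length ys" if "i < length ?xs" "?xs ! i = p" for i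
    using assms(1) that nth_eq_iff_index_eq[of ?xs i "length ys"] by simp
  have ps: "partial_sum V ?xs (length ys) = voting_power V (set ys)"
    "partial_sum V ?xs (Suc (length ys)) = voting_power V (insert p (set ys))"
    using assms(1) by (auto simp: partial_sum_def voting_power_def sum_list_distinct_conv_sum_set)
  have mono: "partial_sum V ?xs j \<le> partial_sum V ?xs (length ys)" if "j \<le> length ys" for j
    using that assms by (intro partial_sum_mono) auto
  have "pivotal V ?xs p \<longleftrightarrow> quota V \<le> partial_sum V ?xs (Suc (length ys)) \<and>
      (\<forall>j\<le>length ys. partial_sum V ?xs j < quota V)"
    unfolding pivotal_def using nth by (auto intro!: exI[of _ "length ys"])
  also have "\<dots> \<longleftrightarrow> quota V \<le> partial_sum V ?xs (Suc (length ys)) \<and>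
      partial_sum V ?xs (length ys) < quota V"
    using mono by (meson le_refl order_le_less_trans)
  also have "\<dots> \<longleftrightarrow> set ys \<in> swings V p"
    unfolding ps using assms(1,2) by (auto simp: swings_def winning_def)
  finally show ?thesis .
qed

text \<open>Split an ordering at \<open>p\<close>: the predecessors form a swing, and the players
  before and after \<open>p\<close> may be arranged independently. This gives the factorial weight
  of each swing.\<close>

lemma card_pivotal_orderings:
  assumes fin: "finite (players V)" and nonneg: "\<And>q. q \<in> players V \<Longrightarrow> 0 \<le> weight V q"
    and p: "p \<in> players V"
  shows "card {xs \<in> sequential_coalitions V. pivotal V xs p} =
    (\<Sum>S\<in>swings V p. fact (card S) * fact (card (players V) - 1 - card S))"
proof -
  let ?perms = "\<lambda>S. permutations_of_set S \<times> permutations_of_set (players V - {p} - S)"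
  let ?join = "\<lambda>(S, ys, zs). ys @ p # zs"
  have "{xs \<in> sequential_coalitions V. pivotal V xs p} = ?join ` Sigma (swings V p) ?perms"
  proof safe
    fix xs assume xs: "xs \<in> sequential_coalitions V" "pivotal V xs p"
    then have "distinct xs" "set xs = players V"
      by (auto simp: sequential_coalitions_def permutations_of_set_def)
    moreover from this p obtain ys zs where eq: "xs = ys @ p # zs"
      by (metis split_list)
    ultimately have "set ys \<in> swings V p" "set zs = players V - {p} - set ys"
      using xs(2) nonneg pivotal_append_Cons_iff[of ys p zs V] by auto
    then show "xs \<in> ?join ` Sigma (swings V p) ?perms"
      using \<open>distinct xs\<close> eq
      by (intro image_eqI[of _ _ "(set ys, ys, zs)"]) (auto simp: permutations_of_set_def)
  next
    fix S ys zs
    assume "S \<in> swings V p" "ys \<in> permutations_of_set S"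
      "zs \<in> permutations_of_set (players V - {p} - S)"
    then have *: "set ys \<in> swings V p" "distinct (ys @ p # zs)" "set (ys @ p # zs) = players V"
      using p by (auto simp: permutations_of_set_def swings_def)
    show "ys @ p # zs \<in> sequential_coalitions V"
      using * by (simp add: sequential_coalitions_def permutations_of_set_def)
    show "pivotal V (ys @ p # zs) p"
      using * nonneg pivotal_append_Cons_iff[of ys p zs V] by simp
  qed
  moreover have "inj_on ?join (Sigma (swings V p) ?perms)"
  proof (rule inj_onI, clarsimp)
    fix S ys zs S' ys' zs'
    assume "S \<in> swings V p" "S' \<in> swings V p" "ys \<in> permutations_of_set S"
      "ys' \<in> permutations_of_set S'" "zs \<in> permutations_of_set (players V - {p} - S)"
      "ys @ p # zs = ys' @ p # zs'"
    moreover from this have "p \<notin> set ys" "p \<notin> set zs"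
      by (auto simp: swings_def permutations_of_set_def)
    ultimately show "S = S' \<and> ys = ys' \<and> zs = zs'"
      using append_Cons_eq_iff[of p ys zs ys' zs'] by (simp add: permutations_of_set_def)
  qed
  ultimately have "card {xs \<in> sequential_coalitions V. pivotal V xs p} =
      card (Sigma (swings V p) ?perms)"
    by (simp only: card_image)
  also have "\<dots> = (\<Sum>S\<in>swings V p. card (?perms S))"
    using finite_swings[OF fin] by (intro card_SigmaI) auto
  also have "\<dots> = (\<Sum>S\<in>swings V p. fact (card S) * fact (card (players V) - 1 - card S))"
  proof (intro sum.cong refl)
    fix S assume S: "S \<in> swings V p"
    then have sub: "S \<subseteq> players V - {p}" by (simp add: swings_def)
    then have "finite S" using fin by (meson finite_Diff finite_subset)
    moreover have "card (players V - {p} - S) = card (players V) - 1 - card S"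
      using sub fin p \<open>finite S\<close> by (simp add: card_Diff_subset)
    ultimately show "card (?perms S) = fact (card S) * fact (card (players V) - 1 - card S)"
      using fin by (simp add: card_cartesian_product)
  qed
  finally show ?thesis .
qed

section \<open>Number of divisors of a non-deficient number\<close>

lemma sum_divisors_prime_power_less:
  fixes p :: nat
  assumes "prime p"
  shows "\<Sum>{d. d dvd p ^ a} < 2 * p ^ a"
proof -
  have "{d. d dvd p ^ a} = (\<lambda>i. p ^ i) ` {..a}"
    using assms by (auto simp: divides_primepow_nat)
  moreover have "inj_on (\<lambda>i. p ^ i) {..a}"
    using prime_gt_1_nat[OF assms] by (auto simp: inj_on_def)
  ultimately have "\<Sum>{d. d dvd p ^ a} = (\<Sum>i\<le>a. p ^ i)"
    by (simp add: sum.reindex)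
  moreover have "(\<Sum>i\<le>a. p ^ i) < 2 * p ^ a"
  proof (induction a)
    case (Suc a)
    have "2 * p ^ a \<le> p * p ^ a" using prime_ge_2_nat[OF assms] by (rule mult_le_mono1)
    with Suc show ?case unfolding sum.atMost_Suc power_Suc by linarith
  qed simp
  ultimately show ?thesis by simp
qed

lemma divisors_prime_mult_prime:
  fixes p q :: nat
  assumes "prime p" "prime q"
  shows "{d. d dvd p * q} = {1, p, q, p * q}"
proof
  show "{d. d dvd p * q} \<subseteq> {1, p, q, p * q}"
  proof
    fix d assume "d \<in> {d. d dvd p * q}"
    then obtain a b where d: "d = a * b" and "a dvd p" "b dvd q"
      using division_decomp[of d p q] by auto
    then have "a = 1 \<or> a = p" "b = 1 \<or> b = q"
      using assms by (simp_all add: prime_nat_iff)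
    then show "d \<in> {1, p, q, p * q}" unfolding d by (elim disjE) simp_all
  qed
qed auto

text \<open>Such an \<open>n\<close> has two distinct prime factors, so
  \<open>n = p * q * r\<close>. If \<open>r = 1\<close>, the size of the divisor sum forces the
  primes to be 2 and 3; otherwise six divisors can be listed.\<close>

lemma not_deficient_few_divisors:
  assumes "n > 1" and "2 * n \<le> sigma n"
  shows "n = 6 \<or> 6 \<le> card {d. d dvd n}"
proof -
  obtain p where p: "prime p" "p dvd n"
    using assms(1) by (metis less_irrefl prime_factor_nat)
  obtain a m where n_eq: "n = p ^ a * m" and "\<not> p dvd m"
    using p assms(1) by (metis multiplicity_decompose' not_less_zero prime_elem_def prime_imp_prime_elem)
  \<comment> \<open>Otherwise \<open>n\<close> would be a prime power, hence deficient.\<close>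
  have "m \<noteq> 1"
    using sum_divisors_prime_power_less[OF p(1), of a] assms(2) n_eq by (auto simp: sigma_def)
  then obtain q where q: "prime q" "q dvd m" using prime_factor_nat by blast
  then have qn: "q dvd n" and pq: "p \<noteq> q" using n_eq \<open>\<not> p dvd m\<close> by auto
  have "p * q dvd n"
    using p q(1) qn pq by (simp add: divides_mult primes_coprime)
  then obtain r where r: "n = p * q * r" by blast
  show ?thesis
  proof (cases "r = 1")
    case True
    have ge: "2 \<le> p" "2 \<le> q" using p(1) q(1) prime_ge_2_nat by auto
    have "sigma n = 1 + p + q + p * q"
      using True r divisors_prime_mult_prime[OF p(1) q(1)] pq ge by (simp add: sigma_def)
    then have le: "p * q \<le> 1 + p + q" using assms(2) True r by simp
    \<comment> \<open>The shift by 2 turns \<open>p * q \<le> 1 + p + q\<close> into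
      \<open>x * y + x + y \<le> 1\<close>, and \<open>p \<noteq> q\<close> excludes
      \<open>x = y = 0\<close>.\<close>
    obtain x y where xy: "p = x + 2" "q = y + 2" using ge by (metis le_add_diff_inverse2)
    have "x * y + x + y \<le> 1" using le xy by (simp add: algebra_simps)
    then have "x + y \<le> 1" by simp
    then have "(x = 1 \<and> y = 0) \<or> (x = 0 \<and> y = 1)" using pq xy by auto
    then show ?thesis using True r xy by auto
  next
    case False
    have gt: "1 < p" "1 < q" using p(1) q(1) prime_gt_1_nat by blast+
    have "1 < r" using False assms(1) r by (cases r) auto
    have div: "{1, p, q, p * q, p * r, q * r, n} \<subseteq> {d. d dvd n}"
      using r by (auto simp: mult.assoc intro: dvd_mult2)
    have lt: "p < p * q" "q < p * q" "p < p * r" "q < q * r" "p * q < n" "p * r < n" "q * r < n"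
      using gt \<open>1 < r\<close> r by simp_all
    have ne: "1 \<noteq> p" "1 \<noteq> q" "1 \<noteq> p * q" "1 \<noteq> p * r" "1 \<noteq> q * r" "p \<noteq> p * q" "q \<noteq> p * q"
      "p \<noteq> p * r" "q \<noteq> q * r" "1 \<noteq> n" "p \<noteq> n" "q \<noteq> n" "p * q \<noteq> n" "p * r \<noteq> n" "q * r \<noteq> n"
      using lt gt by linarith+
    have prime_ne: "q \<noteq> p * r" "p \<noteq> q * r"
      using prime_product[of p r] prime_product[of q r] p(1) q(1) gt \<open>1 < r\<close> by auto
    \<comment> \<open>The seven listed divisors may coincide: \<open>p * r = p * q\<close> if
      \<open>r = q\<close>, and \<open>q * r = p * q\<close> if \<open>r = p\<close>. One of
      \<open>p * r\<close> and \<open>q * r\<close>, chosen suitably, is enough.\<close>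
    have six: "6 \<le> card {1, p, q, p * q, p * r, q * r, n}"
      if "distinct [1, p, q, p * q, x, n]" "x \<in> {p * r, q * r}" for x
    proof -
      have "6 = card (set [1, p, q, p * q, x, n])"
        using distinct_card[OF that(1)] by simp
      also have "\<dots> \<le> card {1, p, q, p * q, p * r, q * r, n}"
        using that(2) by (intro card_mono) auto
      finally show ?thesis .
    qed
    have "6 \<le> card {1, p, q, p * q, p * r, q * r, n}"
    proof (cases "r = q")
      case True
      then have "p * q \<noteq> q * r" using pq gt by simp
      then have "distinct [1, p, q, p * q, q * r, n]"
        using ne prime_ne pq unfolding distinct.simps list.set insert_iff empty_iff by blast
      then show ?thesis by (rule six) simp
    next
      case False
      then have "p * q \<noteq> p * r" using gt by simp
      then have "distinct [1, p, q, p * q, p * r, n]"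
        using ne prime_ne pq unfolding distinct.simps list.set insert_iff empty_iff by blast
      then show ?thesis by (rule six) simp
    qed
    then show ?thesis
      using card_mono[OF _ div] assms(1) by simp
  qed
qed


section \<open>Swing counts in the divisor voting system\<close>

locale near_perfect =
  fixes n k :: nat
  assumes gt1: "1 < n" and sigma_eq: "sigma n = 2 * n + k" and k_le: "k \<le> 5"
begin

abbreviation V :: "nat voting_system" where
  "V \<equiv> divisor_voting_system n"

definition A :: "nat set" where
  "A = {d. d dvd n} - {n}"

abbreviation m :: nat where
  "m \<equiv> card A"

lemma players_eq: "players V = insert n A"
  by (auto simp: divisor_voting_system_def A_def)

lemma finite_A [simp]: "finite A"
  using gt1 by (simp add: A_def)

lemma finite_subset_A: "T \<subseteq> A \<Longrightarrow> finite T"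
  using finite_subset[of T A] by simp

lemma n_notin_A [simp]: "n \<notin> A"
  by (simp add: A_def)

lemma zero_notin_A [simp]: "0 \<notin> A"
  using gt1 by (simp add: A_def)

lemma one_in_A [simp]: "Suc 0 \<in> A"
  using gt1 by (simp add: A_def)

lemma card_players: "card (players V) = Suc m"
  by (simp add: players_eq)

lemma sum_A: "\<Sum>A = n + k"
proof -
  have "sigma n = \<Sum>(insert n A)"
    unfolding sigma_def by (rule sum.cong) (auto simp: A_def)
  then show ?thesis using sigma_eq by simp
qed

text \<open>After doubling, both parity cases of the quota become the same strict inequality between
  integers; for odd \<open>k\<close> equality is impossible by parity.\<close>

lemma winning_iff: "winning V C \<longleftrightarrow> C \<subseteq> insert n A \<and> 2 * n + k < 2 * \<Sum>C"
proof -
  have "voting_power V C = real (\<Sum>C)"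
    by (simp add: voting_power_def divisor_voting_system_def)
  moreover have "quota V \<le> real (\<Sum>C) \<longleftrightarrow> 2 * n + k < 2 * \<Sum>C"
  proof (cases "even (2 * n + k)")
    case True
    then have "quota V = (real (2 * n + k) + 1) / 2"
      by (simp add: divisor_voting_system_def sigma_eq)
    also have "\<dots> \<le> real (\<Sum>C) \<longleftrightarrow> real (2 * n + k + 1) \<le> real (2 * \<Sum>C)"
      by (simp add: algebra_simps)
    finally show ?thesis unfolding of_nat_le_iff by (simp add: Suc_le_eq)
  next
    case False
    then have "quota V = real (2 * n + k) / 2"
      by (simp add: divisor_voting_system_def sigma_eq)
    also have "\<dots> \<le> real (\<Sum>C) \<longleftrightarrow> real (2 * n + k) \<le> real (2 * \<Sum>C)"
      by (simp add: algebra_simps)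
    finally show ?thesis using False unfolding of_nat_le_iff
      by (metis dvd_triv_left le_neq_implies_less less_imp_le)
  qed
  ultimately show ?thesis by (simp add: winning_def players_eq)
qed

text \<open>Members of \<open>A\<close> are positive and {1, 2} already has sum 3. Only the
  membership of 2 is in doubt, as 1 is always a proper divisor. With \<open>h\<close> arbitrary the
  lemma serves both for counting and for weighting.\<close>

lemma sum_small_subsets:
  fixes h :: "nat set \<Rightarrow> nat"
  assumes P: "\<And>T. T \<subseteq> A \<Longrightarrow> P T \<Longrightarrow> \<Sum>T \<le> 2"
  shows "(\<Sum>T | T \<subseteq> A \<and> P T. h T) =
    (if P {} then h {} else 0) + (if P {1} then h {1} else 0) +
    (if 2 \<in> A \<and> P {2} then h {2} else 0)"
proof -
  have small: "T \<in> {{}, {1}, {2}}" if T: "T \<subseteq> A" "P T" for T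
  proof -
    have le: "\<Sum>T \<le> 2" and fin: "finite T" and "0 \<notin> T"
      using T P[of T] finite_subset_A zero_notin_A by blast+
    have "T \<subseteq> {1, 2}"
    proof
      fix x assume "x \<in> T"
      then have "x \<le> \<Sum>T" using fin member_le_sum[of x T "\<lambda>x. x"] by simp
      moreover have "x \<noteq> 0" using \<open>0 \<notin> T\<close> \<open>x \<in> T\<close> by metis
      ultimately show "x \<in> {1, 2}" using le by auto
    qed
    moreover have "T \<noteq> {1, 2}" using le by auto
    moreover have "Pow {1, 2 :: nat} = {{}, {1}, {2}, {1, 2}}"
      by (simp add: Pow_insert insert_commute)
    ultimately show ?thesis by blast
  qed
  have "{T. T \<subseteq> A \<and> P T} = {T \<in> {{}, {1}, {2}}. T \<subseteq> A \<and> P T}"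
    using small by auto
  then have "(\<Sum>T | T \<subseteq> A \<and> P T. h T) =
      (\<Sum>T \<in> {{}, {1}, {2}}. if T \<subseteq> A \<and> P T then h T else 0)"
    by (simp only: sum.inter_filter finite.emptyI finite_insert)
  then show ?thesis by simp
qed

text \<open>With \<open>n\<close> on board, \<open>n\<close> cancels against the threshold
  \<open>2 * n + k\<close>. Without \<open>n\<close>, the total \<open>n + k\<close> of
  \<open>A\<close> lets the coalition be described by the set \<open>U\<close> it misses besides
  \<open>p\<close>. Complementation exchanges losing and winning, hence the exchange of strict and
  weak inequalities.\<close>

lemma swings_eq:
  assumes p: "p \<in> A"
  shows "swings V p =
    insert n ` {T. T \<subseteq> A \<and> p \<notin> T \<and> 2 * \<Sum>T \<le> k \<and> k < 2 * (\<Sum>T + p)} \<union>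
    (\<lambda>U. A - {p} - U) ` {U. U \<subseteq> A \<and> p \<notin> U \<and> 2 * \<Sum>U < k \<and> k \<le> 2 * (\<Sum>U + p)}"
    (is "_ = insert n ` ?I \<union> ?c ` ?O")
proof -
  have pn: "p \<noteq> n" using p by auto
  have with_n: "insert n T \<in> swings V p \<longleftrightarrow> T \<in> ?I" if T: "T \<subseteq> A" for T
  proof -
    have fin: "finite T" "n \<notin> T" using T finite_subset_A by auto
    show ?thesis
    proof (cases "p \<in> T")
      case False
      then have "\<Sum>(insert p (insert n T)) = p + (n + \<Sum>T)" "\<Sum>(insert n T) = n + \<Sum>T"
        using fin pn by simp_all
      then show ?thesis
        using False T p pn by (auto simp: swings_def winning_iff players_eq)
    qed (auto simp: swings_def)
  qed
  have without_n: "?c U \<in> swings V p \<longleftrightarrow> U \<in> ?O" if U: "U \<subseteq> A" "p \<notin> U" for U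
  proof -
    have fin: "finite U" using U finite_subset_A by auto
    have "\<Sum>A = p + \<Sum>(A - {p})" using p by (simp add: sum.remove)
    also have "\<Sum>(A - {p}) = \<Sum>(?c U) + \<Sum>U"
      using U by (intro sum.subset_diff) auto
    finally have eq: "n + k = p + \<Sum>(?c U) + \<Sum>U" using sum_A by simp
    define s where "s = \<Sum>(?c U)"
    have "\<Sum>(insert p (?c U)) = p + s" by (simp add: s_def)
    moreover have "?c U \<subseteq> insert n A" "insert p (?c U) \<subseteq> insert n A" "?c U \<subseteq> players V - {p}"
      using p by (auto simp: players_eq)
    ultimately have "?c U \<in> swings V p \<longleftrightarrow> 2 * s \<le> 2 * n + k \<and> 2 * n + k < 2 * (p + s)"
      by (simp add: swings_def winning_iff not_less s_def)
    also have "2 * s \<le> 2 * n + k \<longleftrightarrow> k \<le> 2 * (\<Sum>U + p)"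
      using eq unfolding s_def[symmetric] by auto
    also have "2 * n + k < 2 * (p + s) \<longleftrightarrow> 2 * \<Sum>U < k"
      using eq unfolding s_def[symmetric] by auto
    finally show ?thesis using U by auto
  qed
  show ?thesis
  proof (intro equalityI subsetI)
    fix S assume S: "S \<in> swings V p"
    then have sub: "S \<subseteq> insert n A" "p \<notin> S" by (auto simp: swings_def players_eq)
    show "S \<in> insert n ` ?I \<union> ?c ` ?O"
    proof (cases "n \<in> S")
      case True
      then have eq: "S = insert n (S - {n})" and "S - {n} \<subseteq> A" using sub by auto
      then have "insert n (S - {n}) \<in> swings V p \<longleftrightarrow> S - {n} \<in> ?I" by (intro with_n)
      then have mem: "S - {n} \<in> ?I" using S eq by simp
      show ?thesis by (subst eq, rule UnI1, rule imageI, rule mem)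
    next
      case False
      then have eq: "S = ?c (A - {p} - S)" using sub by auto
      have "?c (A - {p} - S) \<in> swings V p \<longleftrightarrow> A - {p} - S \<in> ?O" by (intro without_n) auto
      then have mem: "A - {p} - S \<in> ?O" using S eq by simp
      show ?thesis by (subst eq, rule UnI2, rule imageI, rule mem)
    qed
  next
    fix S assume "S \<in> insert n ` ?I \<union> ?c ` ?O"
    then show "S \<in> swings V p"
    proof
      assume "S \<in> insert n ` ?I"
      then obtain T where "S = insert n T" "T \<in> ?I" by (rule imageE)
      then show ?thesis using with_n[of T] by simp
    next
      assume "S \<in> ?c ` ?O"
      then obtain U where "S = ?c U" "U \<in> ?O" by (rule imageE)
      then show ?thesis using without_n[of U] by simp
    qed
  qed
qed

text \<open>Coalitions that contain \<open>n\<close> swing through the few small divisors they contain, the others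
  through the few small divisors they miss; the condition \<open>k \<le> 5\<close> leaves only the sets
  \<open>{}\<close>, \<open>{1}\<close>, \<open>{2}\<close>.\<close>

lemma sum_swings:
  fixes f :: "nat \<Rightarrow> nat"
  assumes p: "p \<in> A"
  shows "(\<Sum>S\<in>swings V p. f (card S)) =
    (if k < 2 * p then f 1 else 0) +
    (if p \<noteq> 1 \<and> 2 \<le> k \<and> k < 2 * (1 + p) then f 2 else 0) +
    (if 2 \<in> A \<and> p \<noteq> 2 \<and> 4 \<le> k \<and> k < 2 * (2 + p) then f 2 else 0) +
    ((if 0 < k \<and> k \<le> 2 * p then f (m - 1) else 0) +
    (if p \<noteq> 1 \<and> 2 < k \<and> k \<le> 2 * (1 + p) then f (m - 2) else 0) +
    (if 2 \<in> A \<and> p \<noteq> 2 \<and> 4 < k \<and> k \<le> 2 * (2 + p) then f (m - 2) else 0))"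
proof -
  let ?P = "\<lambda>T. p \<notin> T \<and> 2 * \<Sum>T \<le> k \<and> k < 2 * (\<Sum>T + p)"
  let ?Q = "\<lambda>U. p \<notin> U \<and> 2 * \<Sum>U < k \<and> k \<le> 2 * (\<Sum>U + p)"
  let ?I = "{T. T \<subseteq> A \<and> ?P T}" and ?O = "{U. U \<subseteq> A \<and> ?Q U}" and ?c = "\<lambda>U. A - {p} - U"
  have fin: "finite ?I" "finite ?O" by (auto intro: finite_subset[of _ "Pow A"])
  \<comment> \<open>Membership of \<open>n\<close> separates the two families, so the sum
    splits.\<close>
  have "n \<in> S" if "S \<in> insert n ` ?I" for S using that by blast
  moreover have "n \<notin> S" if "S \<in> ?c ` ?O" for S using that by auto
  ultimately have "insert n ` ?I \<inter> ?c ` ?O = {}" by blast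
  then have "(\<Sum>S\<in>swings V p. f (card S)) =
      (\<Sum>S\<in>insert n ` ?I. f (card S)) + (\<Sum>S\<in>?c ` ?O. f (card S))"
    unfolding swings_eq[OF p] using fin by (intro sum.union_disjoint) auto
  also have "(\<Sum>S\<in>insert n ` ?I. f (card S)) = (\<Sum>T\<in>?I. f (card (insert n T)))"
  proof (rule sum.reindex[unfolded o_def], rule inj_onI)
    fix S T assume "S \<in> ?I" "T \<in> ?I" "insert n S = insert n T"
    moreover from this have "n \<notin> S" "n \<notin> T" by auto
    ultimately show "S = T" by (simp add: insert_ident)
  qed
  also have "\<dots> = (\<Sum>T\<in>?I. f (Suc (card T)))"
  proof (intro sum.cong refl)
    fix T assume "T \<in> ?I"
    then have "finite T" "n \<notin> T" using finite_subset_A by auto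
    then show "f (card (insert n T)) = f (Suc (card T))" by simp
  qed
  also have "(\<Sum>S\<in>?c ` ?O. f (card S)) = (\<Sum>U\<in>?O. f (card (?c U)))"
    by (rule sum.reindex[unfolded o_def]) (auto simp: inj_on_def)
  also have "\<dots> = (\<Sum>U\<in>?O. f (m - Suc (card U)))"
  proof (intro sum.cong refl)
    fix U assume "U \<in> ?O"
    then have "finite U" "U \<subseteq> A - {p}" using finite_subset_A by auto
    then show "f (card (?c U)) = f (m - Suc (card U))" using p by (simp add: card_Diff_subset)
  qed
  also have "(\<Sum>T\<in>?I. f (Suc (card T))) =
      (if ?P {} then f (Suc (card ({}::nat set))) else 0) +
      (if ?P {1} then f (Suc (card {1::nat})) else 0) +
      (if 2 \<in> A \<and> ?P {2} then f (Suc (card {2::nat})) else 0)"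
    using k_le by (intro sum_small_subsets) auto
  also have "(\<Sum>U\<in>?O. f (m - Suc (card U))) =
      (if ?Q {} then f (m - Suc (card ({}::nat set))) else 0) +
      (if ?Q {1} then f (m - Suc (card {1::nat})) else 0) +
      (if 2 \<in> A \<and> ?Q {2} then f (m - Suc (card {2::nat})) else 0)"
    using k_le by (intro sum_small_subsets) auto
  finally have eq: "(\<Sum>S\<in>swings V p. f (card S)) =
      (if ?P {} then f (Suc (card ({}::nat set))) else 0) +
      (if ?P {1} then f (Suc (card {1::nat})) else 0) +
      (if 2 \<in> A \<and> ?P {2} then f (Suc (card {2::nat})) else 0) +
      ((if ?Q {} then f (m - Suc (card ({}::nat set))) else 0) +
      (if ?Q {1} then f (m - Suc (card {1::nat})) else 0) +
      (if 2 \<in> A \<and> ?Q {2} then f (m - Suc (card {2::nat})) else 0))" .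
  have card: "Suc (card ({}::nat set)) = 1" "Suc (card {1::nat}) = 2" "Suc (card {2::nat}) = 2"
    by simp_all
  show ?thesis
    unfolding eq card by (intro arg_cong2[where f = plus] if_cong; simp)
qed

text \<open>The Shapley-Shubik weight of a swing is a factor \<open>fact (m - 1)\<close> or \<open>2 * fact (m - 2)\<close>,
  according to whether its small set is empty or a singleton; \<open>a p\<close> and \<open>b p\<close>
  count the swings of \<open>p\<close> of either kind.\<close>

definition a :: "nat \<Rightarrow> nat" where
  "a p = of_bool (k < 2 * p) + of_bool (0 < k \<and> k \<le> 2 * p)"

definition b :: "nat \<Rightarrow> nat" where
  "b p = of_bool (p \<noteq> 1 \<and> 2 \<le> k \<and> k < 2 * (1 + p)) +
    of_bool (2 \<in> A \<and> p \<noteq> 2 \<and> 4 \<le> k \<and> k < 2 * (2 + p)) +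
    of_bool (p \<noteq> 1 \<and> 2 < k \<and> k \<le> 2 * (1 + p)) +
    of_bool (2 \<in> A \<and> p \<noteq> 2 \<and> 4 < k \<and> k \<le> 2 * (2 + p))"

lemma critical_count_eq:
  assumes p: "p \<in> A"
  shows "critical_count V p = a p + b p"
proof -
  have "critical_count V p = (\<Sum>S\<in>swings V p. 1)"
    by (simp add: critical_count_eq_card_swings)
  also have "\<dots> = a p + b p"
    unfolding sum_swings[OF p, of "\<lambda>_. 1"] a_def b_def of_bool_def by (simp only: ac_simps)
  finally show ?thesis .
qed

lemma card_pivotal_eq:
  assumes p: "p \<in> A" and m: "2 \<le> m"
  shows "card {xs \<in> sequential_coalitions V. pivotal V xs p} =
    a p * fact (m - 1) + b p * (2 * fact (m - 2))"
proof -
  let ?f = "\<lambda>s. fact s * fact (m - s) :: nat"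
  \<comment> \<open>The weight is symmetric under \<open>s \<mapsto> m - s\<close>, so swings with
    and without \<open>n\<close> get equal weight when their small sets have equal size.\<close>
  have f: "?f 1 = fact (m - 1)" "?f 2 = 2 * fact (m - 2)"
    "?f (m - 1) = fact (m - 1)" "?f (m - 2) = 2 * fact (m - 2)"
    using m by simp_all
  have if_mult: "(if c then x else 0) = of_bool c * x" for c and x :: nat by simp
  have "card {xs \<in> sequential_coalitions V. pivotal V xs p} = (\<Sum>S\<in>swings V p. ?f (card S))"
  proof (subst card_pivotal_orderings)
    show "finite (players V)" "p \<in> players V" using p by (simp_all add: players_eq)
    show "0 \<le> weight V q" for q by (simp add: divisor_voting_system_def)
  qed (simp add: card_players)
  also have "\<dots> = a p * fact (m - 1) + b p * (2 * fact (m - 2))"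
    unfolding sum_swings[OF p, of ?f] f a_def b_def if_mult by (simp only: algebra_simps)
  finally show ?thesis .
qed

text \<open>A subset of \<open>A\<close> is a swing of \<open>n\<close> unless it still loses
  together with \<open>n\<close> or already wins without \<open>n\<close>. The two brackets count
  these exceptions by the small set itself and by its small complement in \<open>A\<close>.\<close>

lemma critical_count_n:
  "critical_count V n + (1 + of_bool (2 \<le> k) + of_bool (2 \<in> A \<and> 4 \<le> k)) +
    (of_bool (0 < k) + of_bool (2 < k) + of_bool (2 \<in> A \<and> 4 < k)) = 2 ^ m"
proof -
  let ?G = "{T. T \<subseteq> A \<and> 2 * \<Sum>T \<le> k}" and ?H = "{U. U \<subseteq> A \<and> 2 * \<Sum>U < k}"
  let ?c = "\<lambda>U. A - U"
  have fin: "finite ?G" "finite ?H" "finite (swings V n)"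
    by (auto intro: finite_subset[of _ "Pow A"] finite_swings simp: players_eq)
  have compl: "\<Sum>(A - U) + \<Sum>U = n + k" if "U \<subseteq> A" for U
    using that sum.subset_diff[of U A "\<lambda>x. x"] sum_A by simp
  have swing: "S \<in> swings V n \<longleftrightarrow> S \<subseteq> A \<and> \<not> 2 * \<Sum>S \<le> k \<and> \<not> 2 * \<Sum>(A - S) < k" for S
  proof (cases "S \<subseteq> A")
    case True
    then have "finite S" "n \<notin> S" using finite_subset_A by auto
    then have "S \<in> swings V n \<longleftrightarrow> \<not> 2 * n + k < 2 * \<Sum>S \<and> 2 * n + k < 2 * (n + \<Sum>S)"
      using True by (auto simp: swings_def winning_iff players_eq)
    also have "\<not> 2 * n + k < 2 * \<Sum>S \<longleftrightarrow> \<not> 2 * \<Sum>(A - S) < k"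
      using compl[OF True] by auto
    finally show ?thesis using True by auto
  qed (auto simp: swings_def players_eq)
  have image: "S \<in> ?c ` ?H \<longleftrightarrow> S \<subseteq> A \<and> 2 * \<Sum>(A - S) < k" for S
    by (auto intro!: image_eqI[of S ?c "A - S"] simp: double_diff)
  have Pow_eq: "Pow A = (swings V n \<union> ?G) \<union> ?c ` ?H"
  proof (rule set_eqI)
    show "S \<in> Pow A \<longleftrightarrow> S \<in> (swings V n \<union> ?G) \<union> ?c ` ?H" for S
      unfolding Un_iff swing image by auto
  qed
  have disjoint: "swings V n \<inter> ?G = {}" "(swings V n \<union> ?G) \<inter> ?c ` ?H = {}"
  proof -
    \<comment> \<open>Adding both inequalities would give
      \<open>2 * (n + k) < 2 * k\<close>.\<close>
    have "\<not> (S \<subseteq> A \<and> 2 * \<Sum>S \<le> k \<and> 2 * \<Sum>(A - S) < k)" for S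
      using compl[of S] gt1 by linarith
    then show "(swings V n \<union> ?G) \<inter> ?c ` ?H = {}"
      unfolding disjoint_iff Un_iff swing image by auto
  qed (auto simp: swing)
  have "2 ^ m = card (Pow A)" by (simp add: card_Pow)
  also have "\<dots> = card (swings V n \<union> ?G) + card (?c ` ?H)"
    unfolding Pow_eq using fin disjoint(2) by (intro card_Un_disjoint) auto
  also have "card (swings V n \<union> ?G) = card (swings V n) + card ?G"
    using fin disjoint(1) by (intro card_Un_disjoint) auto
  also have "card (?c ` ?H) = card ?H"
  proof (intro card_image inj_onI)
    fix S T assume "S \<in> ?H" "T \<in> ?H" and eq: "A - S = A - T"
    then have "S = A - (A - S)" "T = A - (A - T)" by auto
    with eq show "S = T" by simp
  qed
  finally have "2 ^ m = card (swings V n) + card ?G + card ?H" .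
  moreover have "card ?G = 1 + of_bool (2 \<le> k) + of_bool (2 \<in> A \<and> 4 \<le> k)"
    using sum_small_subsets[of "\<lambda>T. 2 * \<Sum>T \<le> k" "\<lambda>_. 1"] k_le by (simp add: of_bool_def)
  moreover have "card ?H = of_bool (0 < k) + of_bool (2 < k) + of_bool (2 \<in> A \<and> 4 < k)"
    using sum_small_subsets[of "\<lambda>T. 2 * \<Sum>T < k" "\<lambda>_. 1"] k_le by (simp add: of_bool_def)
  ultimately show ?thesis by (simp add: critical_count_eq_card_swings)
qed

text \<open>The exception \<open>n = 6\<close> is perfect, so it can occur only for
  \<open>k = 0\<close>.\<close>

lemma few_divisors: "(n = 6 \<and> k = 0 \<and> m = 3) \<or> 5 \<le> m"
proof -
  have card: "card {d. d dvd n} = Suc m"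
    using card_players by (simp add: divisor_voting_system_def)
  have div6: "{d. d dvd (6::nat)} = {1, 2, 3, 6}"
    using divisors_prime_mult_prime[of 2 3] by simp
  have "n = 6 \<or> 5 \<le> m"
    using not_deficient_few_divisors[OF gt1] sigma_eq card by auto
  moreover have "k = 0 \<and> m = 3" if "n = 6"
    using sigma_eq card that div6 by (simp add: sigma_def)
  ultimately show ?thesis by blast
qed

lemma power_two_bounds:
  fixes i :: nat
  assumes "5 \<le> i"
  shows "i\<^sup>2 + 1 < 2 ^ i" and "2 * i\<^sup>2 + 8 < 2 ^ i + 6 * i"
proof -
  have "i\<^sup>2 + 1 < 2 ^ i \<and> 2 * i\<^sup>2 + 8 < 2 ^ i + 6 * i" using assms
  proof (induction i rule: dec_induct)
    case (step l)
    have sq: "(Suc l)\<^sup>2 = l\<^sup>2 + 2 * l + 1" by (simp add: power2_eq_square)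
    \<comment> \<open>This makes both induction steps linear in \<open>l\<close> and
      \<open>l\<^sup>2\<close>.\<close>
    have "5 * l \<le> l\<^sup>2" using step(1) by (simp add: power2_eq_square)
    then show ?case using step unfolding sq power_Suc by simp
  qed simp
  then show "i\<^sup>2 + 1 < 2 ^ i" "2 * i\<^sup>2 + 8 < 2 ^ i + 6 * i" by auto
qed

section \<open>Contradiction from equal indices\<close>

context
  assumes equal: "\<And>d. d dvd n \<Longrightarrow> banzhaf_index V d = shapley_shubik_index V d"
begin

text \<open>Writing \<open>m = j + 2\<close> avoids truncated subtraction and exposes the factor
  \<open>fact j\<close>, which cancels from the Shapley-Shubik index.\<close>

lemma equal_indices_imp:
  assumes p: "p \<in> A" and m: "m = j + 2"
  shows "real (a p + b p) / real (\<Sum>q\<in>players V. critical_count V q) =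
    real (a p * (j + 1) + b p * 2) / real ((j + 3) * (j + 2) * (j + 1))"
proof -
  have "card (sequential_coalitions V) = fact (Suc m)"
    by (simp add: sequential_coalitions_def players_eq)
  also have "\<dots> = (j + 3) * (j + 2) * (j + 1) * fact j"
    by (simp add: m algebra_simps numeral_3_eq_3)
  finally have "shapley_shubik_index V p =
      real ((a p * (j + 1) + b p * 2) * fact j) / real ((j + 3) * (j + 2) * (j + 1) * fact j)"
    unfolding shapley_shubik_index_def using card_pivotal_eq[OF p] m
    by (simp add: algebra_simps)
  also have "\<dots> = real (a p * (j + 1) + b p * 2) / real ((j + 3) * (j + 2) * (j + 1))"
    unfolding of_nat_mult by (rule mult_divide_mult_cancel_right) simp
  finally show ?thesis
    using equal[of p] p by (simp add: banzhaf_index_def critical_count_eq A_def)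
qed

lemma equal_indices_imp_total:
  assumes p: "p \<in> A" and m: "m = j + 2" and pos: "0 < a p + b p"
  shows "(a p + b p) * ((j + 3) * (j + 2) * (j + 1)) =
    (a p * (j + 1) + b p * 2) * (critical_count V n + (\<Sum>q\<in>A. a q + b q))"
proof -
  define t where "t = (\<Sum>q\<in>players V. critical_count V q)"
  have t: "t = critical_count V n + (\<Sum>q\<in>A. a q + b q)"
    unfolding t_def players_eq by (simp add: critical_count_eq)
  \<comment> \<open>Division by zero yields 0, so cross-multiplying requires a nonzero total;
    \<open>p\<close> itself contributes to it.\<close>
  have "t \<noteq> 0"
  proof
    assume "t = 0"
    then have "a p + b p = 0" using p unfolding t by simp
    then show False using pos by simp
  qed
  then have "real (a p + b p) * real ((j + 3) * (j + 2) * (j + 1)) =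
      real (a p * (j + 1) + b p * 2) * real t"
    using equal_indices_imp[OF p m, folded t_def]
    by (subst (asm) frac_eq_eq) (simp_all del: of_nat_mult of_nat_add)
  then show ?thesis unfolding t by (simp only: of_nat_mult[symmetric] of_nat_eq_iff)
qed

text \<open>The unknown total cancels. Expanded over the integers, the equation reads
  \<open>(a p * b q - a q * b p) * (j - 1) = 0\<close>, so two divisors with non-proportional counts
  force \<open>j = 1\<close>, that is \<open>m = 3\<close>.\<close>

lemma equal_indices_imp_ratio:
  assumes p: "p \<in> A" and q: "q \<in> A" and m: "m = j + 2"
  shows "(a p + b p) * (a q * (j + 1) + b q * 2) = (a q + b q) * (a p * (j + 1) + b p * 2)"
proof -
  define t u where "t = real (\<Sum>q\<in>players V. critical_count V q)"
    and "u = real ((j + 3) * (j + 2) * (j + 1))"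
  have "u \<noteq> 0" by (simp add: u_def del: of_nat_mult of_nat_add)
  then have num: "real (a r * (j + 1) + b r * 2) = real (a r + b r) / t * u" if "r \<in> A" for r
    using equal_indices_imp[OF that m, folded t_def u_def] by simp
  have "real (a p + b p) * real (a q * (j + 1) + b q * 2) =
      real (a q + b q) * real (a p * (j + 1) + b p * 2)"
    unfolding num[OF p] num[OF q] by (simp add: ac_simps)
  then show ?thesis by (simp only: of_nat_mult[symmetric] of_nat_eq_iff)
qed

lemma indices_differ: False
proof -
  have m: "m = 3 \<and> k = 0 \<or> 5 \<le> m" using few_divisors by blast
  then obtain j where j: "m = j + 2"
    using le_Suc_ex[of 2 m] by (auto simp: add.commute)
  have ge: "1 \<le> p" if "p \<in> A" for p
    using that zero_notin_A by (cases p) auto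
  \<comment> \<open>A comparison player other than 1. For \<open>k = 5\<close> it must satisfy
    \<open>k < 2 * p\<close>, hence the bound 3; for \<open>m = 3\<close> only \<open>k = 0\<close>
    occurs and 2 suffices.\<close>
  obtain p where p: "p \<in> A" "2 \<le> p" "5 \<le> m \<Longrightarrow> 3 \<le> p"
  proof -
    have "\<exists>p\<in>A. 2 \<le> p \<and> (5 \<le> m \<longrightarrow> 3 \<le> p)"
    proof (rule ccontr)
      assume "\<not> ?thesis"
      then have "A \<subseteq> (if 5 \<le> m then {1, 2} else {1})" using ge by force
      then have "m \<le> card (if 5 \<le> m then {1, 2} else {1::nat})" by (intro card_mono) auto
      then show False using m by (auto split: if_splits)
    qed
    then show ?thesis using that by blast
  qed
  \<comment> \<open>The fourth case merges \<open>k = 3\<close> with larger \<open>k\<close> where 2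
    is not a proper divisor: in both, 1 is never critical and every other proper divisor has
    \<open>a = b = 2\<close>.\<close>
  consider "k = 0" | "k = 1" | "k = 2" | "k = 3 \<or> 4 \<le> k \<and> 2 \<notin> A" | "k = 4" "2 \<in> A" | "k = 5" "2 \<in> A"
    using k_le by linarith
  then show False
  proof cases
    case 1
    have ab: "a q = 1" "b q = 0" if "q \<in> A" for q
      using ge[OF that] 1 unfolding a_def b_def by auto
    have "(j + 1) * ((j + 3) * (j + 2)) = (j + 1) * (critical_count V n + m)"
      using equal_indices_imp_total[OF p(1) j] by (simp add: ab p(1) algebra_simps)
    then have "(j + 3) * (j + 2) = critical_count V n + m"
      unfolding mult_cancel1 by simp
    moreover have "critical_count V n + 1 = 2 ^ m"
      using critical_count_n 1 by simp
    moreover have "(j + 3) * (j + 2) = m\<^sup>2 + m"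
      using j by (simp add: power2_eq_square algebra_simps)
    ultimately have "2 ^ m = m\<^sup>2 + 1" by linarith
    \<comment> \<open>The value \<open>m = 3\<close>, possible here, is excluded by 8 \<noteq>
      10.\<close>
    then show False using m power_two_bounds(1)[of m] by auto
  next
    case 2
    have ab: "a q = 2" "b q = 0" if "q \<in> A" for q
      using ge[OF that] 2 unfolding a_def b_def by auto
    have "(j + 1) * ((j + 3) * (j + 2)) = (j + 1) * (critical_count V n + 2 * m)"
      using equal_indices_imp_total[OF p(1) j] by (simp add: ab p(1) algebra_simps)
    then have "(j + 3) * (j + 2) = critical_count V n + 2 * m"
      unfolding mult_cancel1 by simp
    moreover have "critical_count V n + 2 = 2 ^ m"
      using critical_count_n 2 by simp
    moreover have "(j + 3) * (j + 2) = m\<^sup>2 + m"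
      using j by (simp add: power2_eq_square algebra_simps)
    ultimately have "2 ^ m + m = m\<^sup>2 + 2" by linarith
    \<comment> \<open>Since \<open>m\<^sup>2 - m + 2\<close> is below \<open>m\<^sup>2 + 1\<close>,
      the first bound is enough.\<close>
    then show False using m 2 power_two_bounds(1)[of m] by auto
  next
    case 3
    have ab1: "a 1 = 1" "b 1 = 0" using 3 unfolding a_def b_def by auto
    have abp: "a p = 2" "b p = 1" using 3 p(2) unfolding a_def b_def by auto
    show False
      using equal_indices_imp_ratio[of 1 p, OF _ p(1) j] ab1 abp m 3 j by simp
  next
    case 4
    have ab1: "a 1 = 0" "b 1 = 0" using 4 unfolding a_def b_def by auto
    \<comment> \<open>For \<open>k = 3\<close>, \<open>q \<ge> 2\<close> gives
      \<open>k < 2 * q\<close>; for \<open>k \<ge> 4\<close> the absence of 2 gives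
      \<open>q \<ge> 3\<close>, and again \<open>k \<le> 5 < 2 * q\<close>.\<close>
    have ab: "a q = 2" "b q = 2" if "q \<in> A - {1}" for q
    proof -
      have "2 \<le> q" using ge[of q] that by (cases "q = 1") auto
      moreover have "3 \<le> q" if "k \<noteq> 3" using that calculation 4 \<open>q \<in> A - {1}\<close> by (cases "q = 2") auto
      ultimately show "a q = 2" "b q = 2" using 4 k_le unfolding a_def b_def by auto
    qed
    have "(\<Sum>q\<in>A. a q + b q) = (\<Sum>q\<in>A - {1}. a q + b q)"
      using sum.remove[of A 1 "\<lambda>q. a q + b q"] ab1 by simp
    also have "\<dots> = (\<Sum>q\<in>A - {1}. 4)" by (intro sum.cong) (simp_all add: ab)
    also have "\<dots> = 4 * (m - 1)" by simp
    finally have sum: "(\<Sum>q\<in>A. a q + b q) = 4 * (m - 1)" .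
    \<comment> \<open>The factor arises from \<open>a p * (j + 1) + b p * 2 = 2 * (j + 3)\<close>
      and cancels.\<close>
    have "((j + 3) * 2) * (2 * (j + 2) * (j + 1)) = ((j + 3) * 2) * (critical_count V n + 4 * (m - 1))"
      using equal_indices_imp_total[OF p(1) j] ab[of p] p unfolding sum by (simp add: algebra_simps)
    then have "2 * (j + 2) * (j + 1) = critical_count V n + 4 * (m - 1)"
      unfolding mult_cancel1 by simp
    moreover have "critical_count V n + 4 = 2 ^ m"
      using critical_count_n 4 by auto
    moreover have "2 * (j + 2) * (j + 1) + 2 * m = 2 * m\<^sup>2"
      using j by (simp add: power2_eq_square algebra_simps)
    ultimately have "2 ^ m + 6 * m = 2 * m\<^sup>2 + 8" using j by linarith
    then show False using m 4 power_two_bounds(2)[of m] by auto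
  next
    case 5
    have ab1: "a 1 = 0" "b 1 = 1" using 5 unfolding a_def b_def by auto
    have ab2: "a 2 = 1" "b 2 = 2" using 5 unfolding a_def b_def by auto
    show False
      using equal_indices_imp_ratio[of 1 2, OF _ _ j] ab1 ab2 m 5 j by simp
  next
    case 6
    have ab1: "a 1 = 0" "b 1 = 2" using 6 unfolding a_def b_def by auto
    have abp: "a p = 2" "b p = 4" using 6 p m unfolding a_def b_def by auto
    show False
      using equal_indices_imp_ratio[of 1 p, OF _ p(1) j] ab1 abp m 6 j by simp
  qed
qed

end

end

theorem proposition2p1:
  fixes n :: nat and k :: int
  assumes "n > 1"
    and "int (sigma n) = 2 * int n + k"
    and "0 \<le> k" and "k \<le> 5"
  shows "\<exists>d. d dvd n \<and>
    banzhaf_index (divisor_voting_system n) d \<noteq>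
    shapley_shubik_index (divisor_voting_system n) d"
proof -
  interpret near_perfect n "nat k"
    using assms by unfold_locales linarith+
  show ?thesis using indices_differ by blast
qed

end
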